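(* Let $n\ge 2$, let $x\in \mathrm{SL}_n(\mathbf{R})$ be semisimple, let $p_x$ denote the characteristic polynomial of $x$, and let $a_1,\ldots,a_n\in\mathbf{C}$ denote the eigenvalues of $x$ (with multiplicity). Then $$2\sqrt{\frac{2}{n}}\,\log(M(p_x))\;\le\;\ell(x)\;\le\;2\log(M(p_x)).$$ The lower bound is an equality exactly when there exists $r\in\mathbf{R}$ such that for all $i$, either $|a_i|=r$ or $|a_i|^{-1}=r$. The upper bound is an equality when $|a_i|=1$ for all but at most two of the indices $i$.
   Context: An element of $\mathrm{SL}_n(\mathbf{R})$ is semisimple if it is diagonalizable over $\mathbf{C}$. The Mahler measure of a monic polynomial $p(X)=\prod_{i=1}^n (X-a_i)\in\mathbf{C}[X]$ is $M(p)=\prod_{i=1}^n\max\{1,|a_i|\}$. For semisimple $x\in\mathrm{SL}_n(\mathbf{R})$ with eigenvalues $a_1,\dots,a_n$, the translation length of $x$ is $$\ell(x)=\sqrt{\sum_{i=1}^n 2(\log|a_i|)^2}.$$ (This is the translation length of $x$ acting on $\mathrm{SO}(n)\backslash\mathrm{SL}_n(\mathbf{R})$ with the invariant Riemannian metric given by $\langle X,Y\rangle=2\,\mathrm{tr}(XY)$.) *)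

theory Defs
  imports
    "Jordan_Normal_Form.Char_Poly"
    "Berlekamp_Zassenhaus.Mahler_Measure"
begin

definition SL :: "nat \<Rightarrow> real mat set" where
  "SL n = {x \<in> carrier_mat n n. det x = 1}"

definition semisimple_mat :: "real mat \<Rightarrow> bool" where
  "semisimple_mat x \<longleftrightarrow>
     (\<exists>D. diagonal_mat D \<and> similar_mat (map_mat complex_of_real x) D)"

(* The characteristic polynomial, read in C[X] so that the Mahler measure applies to it and
   its roots are the complex eigenvalues of x with multiplicity. *)
definition char_poly_complex :: "real mat \<Rightarrow> complex poly" where
  "char_poly_complex x = map_poly complex_of_real (char_poly x)"

(* complex_roots_complex lists all roots of a polynomial, repeated according to multiplicity. *)
definition translation_length :: "real mat \<Rightarrow> real" where
  "translation_length x =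
     sqrt (\<Sum>a\<leftarrow>complex_roots_complex (char_poly_complex x). 2 * (ln (cmod a))\<^sup>2)"

(* The order in which complex_roots_complex chooses its list is irrelevant; consequently
   the Mahler measure and the translation length may be computed from any enumeration
   of the roots. *)
lemma mset_complex_roots_complex_linear_factors:
  fixes a :: "nat \<Rightarrow> complex" and n :: nat
  shows "mset (complex_roots_complex (\<Prod>i<n. [:- a i, 1:])) = image_mset a (mset_set {..<n})"
proof (induction n)
  case 0
  show ?case by simp
next
  case (Suc n)
  have nz: "(\<Prod>i<n. [:- a i, 1:]) \<noteq> 0"
    by simp
  have "complex_roots_complex [:- a n, 1:] = [a n]"
  proof -
    have f: "Polynomial.smult (lead_coeff [:- a n, 1:]) (\<Prod>b\<leftarrow>complex_roots_complex [:- a n, 1:]. [:- b, 1:])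
        = [:- a n, 1:]"
      and l: "length (complex_roots_complex [:- a n, 1:]) = 1"
      using complex_roots[of "[:- a n, 1:]"] by auto
    from l obtain b where "complex_roots_complex [:- a n, 1:] = [b]"
      unfolding One_nat_def length_Suc_conv length_0_conv by blast
    with f show ?thesis by simp
  qed
  moreover have "mset (complex_roots_complex ((\<Prod>i<n. [:- a i, 1:]) * [:- a n, 1:])) =
      mset (complex_roots_complex (\<Prod>i<n. [:- a i, 1:])) + mset (complex_roots_complex [:- a n, 1:])"
    using nz by (intro complex_roots_complex_prod) auto
  ultimately show ?case
    using Suc.IH by (simp add: lessThan_Suc)
qed

lemma mahler_measure_poly_linear_factors:
  fixes a :: "nat \<Rightarrow> complex" and n :: nat
  shows "mahler_measure_poly (\<Prod>i<n. [:- a i, 1:]) = (\<Prod>i<n. max 1 (cmod (a i)))"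
proof -
  let ?p = "\<Prod>i<n. [:- a i, 1:]"
  have "lead_coeff ?p = 1"
    by (simp add: lead_coeff_prod)
  then have "mahler_measure_poly ?p = (\<Prod>b\<in>#mset (complex_roots_complex ?p). max 1 (cmod b))"
    unfolding mahler_measure_poly_def by (simp flip: prod_mset_prod_list)
  also have "\<dots> = (\<Prod>i<n. max 1 (cmod (a i)))"
    unfolding mset_complex_roots_complex_linear_factors
    by (simp add: prod_unfold_prod_mset image_mset.compositionality comp_def)
  finally show ?thesis .
qed

lemma translation_length_eigenvalues:
  fixes a :: "nat \<Rightarrow> complex" and n :: nat
  assumes "char_poly_complex x = (\<Prod>i<n. [:- a i, 1:])"
  shows "translation_length x = sqrt (\<Sum>i<n. 2 * (ln (cmod (a i)))\<^sup>2)"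
proof -
  let ?p = "\<Prod>i<n. [:- a i, 1:]"
  have "(\<Sum>b\<leftarrow>complex_roots_complex ?p. 2 * (ln (cmod b))\<^sup>2) =
      (\<Sum>b\<in>#mset (complex_roots_complex ?p). 2 * (ln (cmod b))\<^sup>2)"
    by (simp flip: sum_mset_sum_list)
  also have "\<dots> = (\<Sum>i<n. 2 * (ln (cmod (a i)))\<^sup>2)"
    unfolding mset_complex_roots_complex_linear_factors
    by (simp add: sum_unfold_sum_mset image_mset.compositionality comp_def)
  finally show ?thesis
    unfolding translation_length_def assms by simp
qed

end

theory Submission
  imports Defs
begin

text \<open>Put \<open>b\<^sub>i = ln |a\<^sub>i|\<close>. As the determinant is 1, the \<open>b\<^sub>i\<close> sum to 0, so their positive and
  negative parts have the same sum \<open>ln M\<close>, and \<open>\<Sum> |b\<^sub>i| = 2 ln M\<close>. The lower bound is the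
  nonnegativity of the variance of the \<open>|b\<^sub>i|\<close>; the upper bound holds because, separately for the
  positive and the negative parts, the sum of the squares is at most the square of the sum.\<close>

text \<open>Both sides come from the characteristic polynomial at 0: it equals the determinant of
  \<open>- x\<close> and also the product of the \<open>- a i\<close>. Taking absolute values
  removes the signs.\<close>

lemma cmod_prod_roots_char_poly:
  fixes a :: "nat \<Rightarrow> complex"
  assumes x: "x \<in> carrier_mat n n"
    and cp: "char_poly_complex x = (\<Prod>i<m. [:- a i, 1:])"
  shows "(\<Prod>i<m. cmod (a i)) = \<bar>det x\<bar>"
proof -
  have "- char_matrix x 0 = (- 1) \<cdot>\<^sub>m x"
    using x by (auto simp: char_matrix_def)
  then have "poly (char_poly x) 0 = (- 1) ^ n * det x"
    using x by (simp add: char_poly_matrix[of x n])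
  then have "complex_of_real ((- 1) ^ n * det x) = poly (char_poly_complex x) 0"
    by (metis char_poly_complex_def of_real_0 of_real_hom.poly_map_poly)
  then have "cmod (complex_of_real ((- 1) ^ n * det x)) = (\<Prod>i<m. cmod (a i))"
    by (simp add: cp poly_prod flip: prod_norm)
  then show ?thesis
    unfolding norm_of_real by (simp add: abs_mult power_abs)
qed

text \<open>Expanding the square of the sum adds only cross terms, which are nonnegative.\<close>

lemma sum_squares_le_square_sum:
  fixes f :: "'a \<Rightarrow> real"
  assumes "finite A" and "\<And>i. i \<in> A \<Longrightarrow> f i \<ge> 0"
  shows "(\<Sum>i\<in>A. (f i)\<^sup>2) \<le> (\<Sum>i\<in>A. f i)\<^sup>2"
  using assms
proof (induction A rule: finite_induct)
  case (insert j A)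
  moreover have "f j * sum f A \<ge> 0"
    using insert.prems by (simp add: sum_nonneg)
  ultimately show ?case
    by (simp add: power2_sum)
qed simp

text \<open>The two usual formulas for the variance, scaled by \<open>card A\<close>. Nonnegativity
  of the left side gives the lower bound, and its vanishing gives the equality case.\<close>

lemma sum_deviation_squares:
  fixes f :: "'a \<Rightarrow> real"
  assumes "finite A" and "A \<noteq> {}"
  shows "(\<Sum>i\<in>A. (f i - sum f A / card A)\<^sup>2) = (\<Sum>i\<in>A. (f i)\<^sup>2) - (sum f A)\<^sup>2 / card A"
proof -
  define m where "m = sum f A / card A"
  have s: "sum f A = card A * m"
    using assms by (simp add: m_def)
  have "(\<Sum>i\<in>A. (f i - m)\<^sup>2) = (\<Sum>i\<in>A. (f i)\<^sup>2) - 2 * m * sum f A + card A * m\<^sup>2"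
    by (simp add: power2_diff sum.distrib sum_subtractf sum_distrib_left sum_distrib_right mult_ac)
  also have "\<dots> = (\<Sum>i\<in>A. (f i)\<^sup>2) - (sum f A)\<^sup>2 / card A"
    using assms by (simp add: s power2_eq_square)
  finally show ?thesis
    by (simp add: m_def)
qed

text \<open>The equality case of Cauchy-Schwarz against the constant vector 1: equality forces every
  deviation from the mean to vanish, so the constant is the mean.\<close>

lemma square_sum_eq_iff_constant:
  fixes f :: "'a \<Rightarrow> real"
  assumes "finite A" and "A \<noteq> {}"
  shows "(sum f A)\<^sup>2 = card A * (\<Sum>i\<in>A. (f i)\<^sup>2) \<longleftrightarrow> (\<exists>c. \<forall>i\<in>A. f i = c)"
proof
  assume "(sum f A)\<^sup>2 = card A * (\<Sum>i\<in>A. (f i)\<^sup>2)"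
  then have "(\<Sum>i\<in>A. (f i - sum f A / card A)\<^sup>2) = 0"
    using assms by (simp add: sum_deviation_squares)
  then have "\<forall>i\<in>A. (f i - sum f A / card A)\<^sup>2 = 0"
    by (rule iffD1[OF sum_nonneg_eq_0_iff[OF assms(1) zero_le_power2]])
  then have "\<forall>i\<in>A. f i = sum f A / card A"
    unfolding power2_eq_square mult_eq_0_iff disj_absorb right_minus_eq .
  then show "\<exists>c. \<forall>i\<in>A. f i = c"
    by (rule exI[of _ "sum f A / card A"])
next
  assume "\<exists>c. \<forall>i\<in>A. f i = c"
  then obtain c where c: "\<forall>i\<in>A. f i = c" ..
  have "sum f A = card A * c" "(\<Sum>i\<in>A. (f i)\<^sup>2) = card A * c\<^sup>2"
    using c by simp_all
  then show "(sum f A)\<^sup>2 = card A * (\<Sum>i\<in>A. (f i)\<^sup>2)"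
    by (simp add: power2_eq_square)
qed

context
  fixes A :: "'a set" and b :: "'a \<Rightarrow> real"
  assumes fin: "finite A" and sum0: "sum b A = 0"
begin

lemma sum_neg_part: "(\<Sum>i\<in>A. max 0 (- b i)) = (\<Sum>i\<in>A. max 0 (b i))"
proof -
  have "(\<Sum>i\<in>A. max 0 (b i)) - (\<Sum>i\<in>A. max 0 (- b i)) = sum b A"
    unfolding sum_subtractf[symmetric] by (intro sum.cong) auto
  then show ?thesis
    by (simp add: sum0)
qed

lemma sum_abs_eq: "(\<Sum>i\<in>A. \<bar>b i\<bar>) = 2 * (\<Sum>i\<in>A. max 0 (b i))"
proof -
  have "(\<Sum>i\<in>A. \<bar>b i\<bar>) = (\<Sum>i\<in>A. max 0 (b i)) + (\<Sum>i\<in>A. max 0 (- b i))"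
    unfolding sum.distrib[symmetric] by (intro sum.cong) auto
  then show ?thesis
    by (simp add: sum_neg_part)
qed

lemma sum_squares_le_pos_part: "(\<Sum>i\<in>A. (b i)\<^sup>2) \<le> 2 * (\<Sum>i\<in>A. max 0 (b i))\<^sup>2"
proof -
  \<comment> \<open>At each index one of the two parts is zero, so the squares add without a cross
    term.\<close>
  have "(\<Sum>i\<in>A. (b i)\<^sup>2) = (\<Sum>i\<in>A. (max 0 (b i))\<^sup>2) + (\<Sum>i\<in>A. (max 0 (- b i))\<^sup>2)"
    unfolding sum.distrib[symmetric] by (intro sum.cong) (auto simp: max_def)
  also have "\<dots> \<le> (\<Sum>i\<in>A. max 0 (b i))\<^sup>2 + (\<Sum>i\<in>A. max 0 (- b i))\<^sup>2"
    using fin by (intro add_mono sum_squares_le_square_sum) auto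
  finally show ?thesis
    by (simp add: sum_neg_part)
qed

text \<open>The nonzero values still sum to 0. If there are at most two of them, they are absent or
  of the form t, -t, and then both sides equal twice the square of t; a single one would have to be
  0.\<close>

lemma sum_squares_eq_pos_part:
  assumes "card {i \<in> A. b i \<noteq> 0} \<le> 2"
  shows "(\<Sum>i\<in>A. (b i)\<^sup>2) = 2 * (\<Sum>i\<in>A. max 0 (b i))\<^sup>2"
proof -
  let ?S = "{i \<in> A. b i \<noteq> 0}"
  \<comment> \<open>Stated for every \<open>g\<close> fixing 0, since it serves the identity, the
    square and the positive part.\<close>
  have restrict: "(\<Sum>i\<in>A. g (b i)) = (\<Sum>i\<in>?S. g (b i))" if "g 0 = 0" for g :: "real \<Rightarrow> real"
    using fin that by (intro sum.mono_neutral_right) auto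
  have sumS: "sum b ?S = 0"
    using restrict[of "\<lambda>t. t"] sum0 by simp
  have "(\<Sum>i\<in>?S. (b i)\<^sup>2) = 2 * (\<Sum>i\<in>?S. max 0 (b i))\<^sup>2"
  proof -
    consider "card ?S = 0" | "card ?S = 1" | "card ?S = 2"
      using assms by linarith
    then show ?thesis
    proof cases
      case 1
      then have "?S = {}"
        using fin by simp
      then show ?thesis by (simp only: sum.empty) simp
    next
      case 2
      then obtain j where "?S = {j}"
        by (auto simp: card_1_singleton_iff)
      with sumS show ?thesis by simp
    next
      case 3
      then obtain j k where S: "?S = {j, k}" and "j \<noteq> k"
        by (auto simp: card_2_iff)
      with sumS have "b k = - b j" by simp
      with \<open>j \<noteq> k\<close> show ?thesis
        unfolding S by (auto simp: max_def)
    qed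
  qed
  then show ?thesis
    using restrict[of "\<lambda>t. t\<^sup>2"] restrict[of "max 0"] by simp
qed

end

lemma ln_max_one:
  fixes t :: real
  assumes "t > 0"
  shows "ln (max 1 t) = max 0 (ln t)"
  using assms by (auto simp: max_def)

text \<open>The witnesses are \<open>exp d\<close> for \<open>r\<close> and
  \<open>\<bar>ln r\<bar>\<close> for \<open>d\<close>; the inverse accounts for the values whose
  logarithm is negative.\<close>

lemma abs_ln_const_iff:
  fixes c :: "'a \<Rightarrow> real"
  assumes "\<And>i. i \<in> A \<Longrightarrow> c i > 0"
  shows "(\<exists>d. \<forall>i\<in>A. \<bar>ln (c i)\<bar> = d) \<longleftrightarrow> (\<exists>r. \<forall>i\<in>A. c i = r \<or> inverse (c i) = r)"
proof
  assume "\<exists>d. \<forall>i\<in>A. \<bar>ln (c i)\<bar> = d"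
  then obtain d where d: "\<forall>i\<in>A. \<bar>ln (c i)\<bar> = d" ..
  have "c i = exp d \<or> inverse (c i) = exp d" if "i \<in> A" for i
    using bspec[OF d that] assms[OF that] by (auto simp: abs_if exp_minus split: if_splits)
  then show "\<exists>r. \<forall>i\<in>A. c i = r \<or> inverse (c i) = r"
    by blast
next
  assume "\<exists>r. \<forall>i\<in>A. c i = r \<or> inverse (c i) = r"
  then obtain r where r: "\<forall>i\<in>A. c i = r \<or> inverse (c i) = r" ..
  have "\<bar>ln (c i)\<bar> = \<bar>ln r\<bar>" if "i \<in> A" for i
    using bspec[OF r that] assms[OF that] by (auto simp: ln_inverse)
  then show "\<exists>d. \<forall>i\<in>A. \<bar>ln (c i)\<bar> = d"
    by blast
qed

theorem theorem1:
  fixes n :: nat and x :: "real mat" and a :: "nat \<Rightarrow> complex"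
  assumes "n \<ge> 2"
    and "x \<in> SL n"
    and "semisimple_mat x"
    and "char_poly_complex x = (\<Prod>i<n. [:- a i, 1:])"
  shows "2 * sqrt (2 / real n) * ln (mahler_measure_poly (char_poly_complex x)) \<le> translation_length x
       \<and> translation_length x \<le> 2 * ln (mahler_measure_poly (char_poly_complex x))
       \<and> (2 * sqrt (2 / real n) * ln (mahler_measure_poly (char_poly_complex x)) = translation_length x
            \<longleftrightarrow> (\<exists>r::real. \<forall>i<n. cmod (a i) = r \<or> inverse (cmod (a i)) = r))
       \<and> (card {i. i < n \<and> cmod (a i) \<noteq> 1} \<le> 2
            \<longrightarrow> translation_length x = 2 * ln (mahler_measure_poly (char_poly_complex x)))"
proof -
  define b where "b i = ln (cmod (a i))" for i
  define L where "L = ln (mahler_measure_poly (char_poly_complex x))"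
  \<comment> \<open>\<open>K\<close> is the square of the sum of the \<open>\<bar>b i\<bar>\<close>,
    divided by \<open>n\<close>. The lower bound, the length and the upper bound are the square
    roots of \<open>2 * K\<close>, \<open>2 * Q\<close> and \<open>2 * (2 * L\<^sup>2)\<close>, so
    all four claims reduce to comparing \<open>K\<close>, \<open>Q\<close> and
    \<open>2 * L\<^sup>2\<close>.\<close>
  define K where "K = (2 * L)\<^sup>2 / n"
  define Q where "Q = (\<Sum>i<n. (b i)\<^sup>2)"
  have n: "n > 0" "{..<n} \<noteq> {}"
    using assms(1) by (auto simp: lessThan_empty_iff)
  have prod1: "(\<Prod>i<n. cmod (a i)) = 1"
    using assms(2) cmod_prod_roots_char_poly[OF _ assms(4)] by (auto simp: SL_def)
  \<comment> \<open>A zero eigenvalue would make the product 0, so every logarithm below is taken at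
    a positive number.\<close>
  have pos: "cmod (a i) > 0" if "i < n" for i
    using prod1 that by (metis finite_lessThan lessThan_iff norm_zero prod_zero zero_less_norm_iff zero_neq_one)
  have sum0: "sum b {..<n} = 0"
    using ln_prod[of "{..<n}" "\<lambda>i. cmod (a i)"] prod1 pos by (simp add: b_def)
  have L: "L = (\<Sum>i<n. max 0 (b i))"
    unfolding L_def assms(4) mahler_measure_poly_linear_factors b_def
    using pos by (subst ln_prod) (auto simp: ln_max_one less_max_iff_disj)
  have L0: "L \<ge> 0"
    unfolding L by (simp add: sum_nonneg)
  have abs_sum: "(\<Sum>i<n. \<bar>b i\<bar>) = 2 * L"
    unfolding L by (rule sum_abs_eq[OF _ sum0]) simp
  have len: "translation_length x = sqrt (2 * Q)"
    unfolding translation_length_eigenvalues[OF assms(4)] Q_def b_def sum_distrib_left ..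
  have lower: "2 * sqrt (2 / real n) * L = sqrt (2 * K)"
    using L0 unfolding K_def by (intro real_sqrt_unique[symmetric]) (auto simp: power_mult_distrib)
  have upper: "2 * L = sqrt (2 * (2 * L\<^sup>2))"
    using L0 by (intro real_sqrt_unique[symmetric]) (auto simp: power_mult_distrib)
  have "K \<le> Q"
  proof -
    \<comment> \<open>The mean of the \<open>\<bar>b i\<bar>\<close> is \<open>2 * L / n\<close>, so
      the sum of squared deviations is \<open>Q - K\<close>.\<close>
    have "0 \<le> (\<Sum>i<n. (\<bar>b i\<bar> - (\<Sum>i<n. \<bar>b i\<bar>) / card {..<n})\<^sup>2)"
      by (simp add: sum_nonneg)
    then show ?thesis
      using n by (subst (asm) sum_deviation_squares) (simp_all add: abs_sum Q_def K_def)
  qed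
  moreover have "Q \<le> 2 * L\<^sup>2"
    unfolding Q_def L by (rule sum_squares_le_pos_part[OF _ sum0]) simp
  moreover have "K = Q \<longleftrightarrow> (\<exists>r. \<forall>i<n. cmod (a i) = r \<or> inverse (cmod (a i)) = r)"
  proof -
    have "K = Q \<longleftrightarrow> (2 * L)\<^sup>2 = card {..<n} * (\<Sum>i<n. \<bar>b i\<bar>\<^sup>2)"
      using n by (auto simp: Q_def K_def field_simps)
    also have "\<dots> \<longleftrightarrow> (\<exists>d. \<forall>i\<in>{..<n}. \<bar>b i\<bar> = d)"
      unfolding abs_sum[symmetric] by (rule square_sum_eq_iff_constant) (use n in auto)
    also have "\<dots> \<longleftrightarrow> (\<exists>r. \<forall>i\<in>{..<n}. cmod (a i) = r \<or> inverse (cmod (a i)) = r)"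
      unfolding b_def by (rule abs_ln_const_iff, rule pos) simp
    finally show ?thesis
      by (simp only: Ball_def lessThan_iff)
  qed
  moreover have "Q = 2 * L\<^sup>2" if "card {i. i < n \<and> cmod (a i) \<noteq> 1} \<le> 2"
  proof -
    have "{i \<in> {..<n}. b i \<noteq> 0} = {i. i < n \<and> cmod (a i) \<noteq> 1}"
      using pos by (auto simp: b_def)
    with that show ?thesis
      unfolding Q_def L by (intro sum_squares_eq_pos_part[OF _ sum0]) auto
  qed
  ultimately show ?thesis
    unfolding L_def[symmetric] len lower unfolding upper by simp
qed

end
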